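(* Let $\mathbb{S}_1,\mathbb{S}_2,\mathbb{S}_3$ be Borel subsets of Polish spaces. A stochastic kernel $\Psi$ on $\mathbb{S}_1\times\mathbb{S}_2$ given $\mathbb{S}_3$ is semi-uniform Feller if and only if the following holds: for each $s_3\in\mathbb{S}_3$ the topology on $\mathbb{S}_1$ has a countable base $\tau_b^{s_3}(\mathbb{S}_1)$ (possibly depending on $s_3$) such that (i) $\mathbb{S}_1\in\tau_b^{s_3}(\mathbb{S}_1)$; (ii) for each finite intersection $\mathcal{O}=\cap_{i=1}^k\mathcal{O}_i$, $k=1,2,\ldots$, of sets $\mathcal{O}_i\in\tau_b^{s_3}(\mathbb{S}_1)$, $i=1,2,\ldots,k$, the set of functions $\mathtt{F}^\Psi_{\mathcal{O}}=\{s\mapsto\Psi(\mathcal{O}\times B|s)\,:\,B\in\mathcal{B}(\mathbb{S}_2)\}$ on $\mathbb{S}_3$ is equicontinuous at $s_3$.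
   Context: A Polish space is a complete separable metric space. Borel subsets of Polish spaces are considered as metric spaces with the restricted metric. $\mathcal{B}(\mathbb{S})$ is the Borel $\sigma$-field of a metric space $\mathbb{S}$. A stochastic kernel $\Psi$ on $\mathbb{S}_1\times\mathbb{S}_2$ given $\mathbb{S}_3$ is a mapping $\Psi:\mathcal{B}(\mathbb{S}_1\times\mathbb{S}_2)\times\mathbb{S}_3\to[0,1]$ such that $\Psi(\,\cdot\,|s_3)$ is a probability measure on $\mathbb{S}_1\times\mathbb{S}_2$ for every $s_3\in\mathbb{S}_3$, and $\Psi(D|\,\cdot\,)$ is Borel-measurable on $\mathbb{S}_3$ for every $D\in\mathcal{B}(\mathbb{S}_1\times\mathbb{S}_2)$. Write $\Psi(A,B|s_3):=\Psi(A\times B|s_3)$, so $\Psi(ds_1,B|s_3)$ is the finite measure $A\mapsto\Psi(A\times B|s_3)$ on $\mathbb{S}_1$. $\Psi$ is semi-uniform Feller if, for each sequence $s_3^{(n)}\to s_3$ in $\mathbb{S}_3$ and each bounded continuous function $f$ on $\mathbb{S}_1$, $$\lim_{n\to\infty}\sup_{B\in\mathcal{B}(\mathbb{S}_2)}\left|\int_{\mathbb{S}_1}f(s_1)\,\Psi(ds_1,B|s_3^{(n)})-\int_{\mathbb{S}_1}f(s_1)\,\Psi(ds_1,B|s_3)\right|=0.$$ A set $\mathtt{F}$ of real-valued functions on a metric space $\mathbb{S}$ is equicontinuous at $s\in\mathbb{S}$ if $\lim_{s'\to s}\sup_{f\in\mathtt{F}}|f(s')-f(s)|=0$. *)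

theory Defs
  imports "HOL-Probability.Probability"
begin

text \<open>
  A subset \<open>S\<close> of a metric space carries the restricted metric. Its Borel \<open>\<sigma>\<close>-field is the trace
  on \<open>S\<close> of the ambient one, and its topology is \<^term>\<open>top_of_set S\<close>.
\<close>

abbreviation borel_on :: "'a::topological_space set \<Rightarrow> 'a measure" where
  "borel_on S \<equiv> restrict_space borel S"

definition stochastic_kernel ::
  "'a::metric_space set \<Rightarrow> 'b::metric_space set \<Rightarrow> 'c::metric_space set \<Rightarrow>
    ('c \<Rightarrow> ('a \<times> 'b) measure) \<Rightarrow> bool" where
  "stochastic_kernel S1 S2 S3 \<Psi> \<longleftrightarrow>
    (\<forall>s\<in>S3. prob_space (\<Psi> s) \<and> sets (\<Psi> s) = sets (borel_on (S1 \<times> S2))) \<and>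
    (\<forall>D\<in>sets (borel_on (S1 \<times> S2)). (\<lambda>s. measure (\<Psi> s) D) \<in> borel_measurable (borel_on S3))"

text \<open>The measure \<open>\<Psi>(ds\<^sub>1, B | s)\<close> on \<open>S\<^sub>1\<close>, where \<open>M\<close> is \<open>\<Psi>(\<cdot> | s)\<close>.\<close>

definition slice_measure ::
  "'a::metric_space set \<Rightarrow> ('a \<times> 'b) measure \<Rightarrow> 'b set \<Rightarrow> 'a measure" where
  "slice_measure S1 M B =
    measure_of S1 (sets (borel_on S1)) (\<lambda>A. emeasure M (A \<times> B))"

lemma sets_slice_measure: "sets (slice_measure S1 M B) = sets (borel_on S1)"
  unfolding slice_measure_def
  by (metis sets.sets_measure_of_eq space_restrict_space2 space_borel space_restrict_space Int_UNIV_right)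

text \<open>
  \<^term>\<open>measure_of\<close> returns the null measure when its last argument is not a measure; the
  following lemma shows that this does not happen here.
\<close>

lemma emeasure_slice_measure:
  fixes M :: "('a::{metric_space,second_countable_topology} \<times>
                'b::{metric_space,second_countable_topology}) measure"
  assumes M: "sets M = sets (borel_on (S1 \<times> S2))"
    and B: "B \<in> sets (borel_on S2)" and A: "A \<in> sets (borel_on S1)"
  shows "emeasure (slice_measure S1 M B) A = emeasure M (A \<times> B)"
proof -
  have rect: "X \<times> B \<in> sets M" if X: "X \<in> sets (borel_on S1)" for X
  proof -
    obtain X' where X': "X' \<in> sets borel" "X = S1 \<inter> X'"
      using X by (auto simp: sets_restrict_space)
    obtain B' where B': "B' \<in> sets borel" "B = S2 \<inter> B'"
      using B by (auto simp: sets_restrict_space)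
    have "X' \<times> B' \<in> sets (borel :: ('a \<times> 'b) measure)"
      using X' B' by (intro borel_Times)
    moreover have "X \<times> B = (S1 \<times> S2) \<inter> (X' \<times> B')"
      using X' B' by auto
    ultimately show ?thesis
      unfolding M sets_restrict_space by auto
  qed
  have sp: "space (borel_on S1) = S1"
    by (simp add: space_restrict_space)
  show ?thesis
    unfolding slice_measure_def
  proof (rule emeasure_measure_of_sigma)
    show "sigma_algebra S1 (sets (borel_on S1))"
      using sets.sigma_algebra_axioms[of "borel_on S1"] by (simp add: sp)
    show "positive (sets (borel_on S1)) (\<lambda>A. emeasure M (A \<times> B))"
      by (simp add: positive_def)
    show "countably_additive (sets (borel_on S1)) (\<lambda>A. emeasure M (A \<times> B))"
    proof (rule countably_additiveI)
      fix F :: "nat \<Rightarrow> 'a set"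
      assume F: "range F \<subseteq> sets (borel_on S1)" "disjoint_family F"
      have "(\<Sum>i. emeasure M (F i \<times> B)) = emeasure M (\<Union>i. F i \<times> B)"
        using F rect by (intro suminf_emeasure) (auto simp: disjoint_family_on_def)
      also have "(\<Union>i. F i \<times> B) = (\<Union>i. F i) \<times> B"
        by auto
      finally show "(\<Sum>i. emeasure M (F i \<times> B)) = emeasure M ((\<Union>i. F i) \<times> B)" .
    qed
    show "A \<in> sets (borel_on S1)"
      by (rule A)
  qed
qed

text \<open>
  Suprema of absolute values are taken in \<^typ>\<open>ennreal\<close>, so that they are meaningful for unbounded
  families and equal \<open>0\<close> for the empty family.
\<close>

definition semi_uniform_Feller ::
  "'a::metric_space set \<Rightarrow> 'b::metric_space set \<Rightarrow> 'c::metric_space set \<Rightarrow>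
    ('c \<Rightarrow> ('a \<times> 'b) measure) \<Rightarrow> bool" where
  "semi_uniform_Feller S1 S2 S3 \<Psi> \<longleftrightarrow>
    (\<forall>(X :: nat \<Rightarrow> 'c) s (f :: 'a \<Rightarrow> real).
      (\<forall>n. X n \<in> S3) \<longrightarrow> s \<in> S3 \<longrightarrow> X \<longlonglongrightarrow> s \<longrightarrow>
      continuous_on S1 f \<longrightarrow> bounded (f ` S1) \<longrightarrow>
      (\<lambda>n. SUP B\<in>sets (borel_on S2).
        ennreal \<bar>(\<integral>x. f x \<partial>slice_measure S1 (\<Psi> (X n)) B) -
                 (\<integral>x. f x \<partial>slice_measure S1 (\<Psi> s) B)\<bar>) \<longlonglongrightarrow> 0)"

definition equicontinuous_at :: "'c::metric_space set \<Rightarrow> 'c \<Rightarrow> ('c \<Rightarrow> real) set \<Rightarrow> bool" where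
  "equicontinuous_at S s F \<longleftrightarrow>
    ((\<lambda>s'. SUP f\<in>F. ennreal \<bar>f s' - f s\<bar>) \<longlongrightarrow> 0) (at s within S)"

definition countable_base :: "'a topology \<Rightarrow> 'a set set \<Rightarrow> bool" where
  "countable_base T \<B> \<longleftrightarrow>
    countable \<B> \<and> (\<forall>U\<in>\<B>. openin T U) \<and> (\<forall>U. openin T U \<longrightarrow> (\<exists>\<U>\<subseteq>\<B>. \<Union>\<U> = U))"

definition kernel_family ::
  "'b::metric_space set \<Rightarrow> ('c \<Rightarrow> ('a \<times> 'b) measure) \<Rightarrow> 'a set \<Rightarrow> ('c \<Rightarrow> real) set" where
  "kernel_family S2 \<Psi> U = {\<lambda>s. measure (\<Psi> s) (U \<times> B) | B. B \<in> sets (borel_on S2)}"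

end

(* Call f uniformly lower semicontinuous at s if the integrals of f against the measures
   \<Psi>(ds1, B | s') are at least those at s minus \<epsilon>, for all B at once and all s' near s.
   Such f are stable under sums, nonnegative multiples and approximation from below in mean of the
   marginal \<Psi>(ds1, S2 | s). Both sides of the equivalence say that this holds for both signs
   of certain functions: bounded continuous f, or indicators of finite intersections of base sets.

   If the kernel is semi-uniform Feller, take the base of balls around a countable dense set with
   radii whose spheres are null for the marginal at s. Finite intersections of such balls can be
   squeezed between continuous functions whose integrals are arbitrarily close.

   Conversely, inclusion-exclusion passes from finite intersections to finite unions of base sets,
   monotone exhaustion to open sets (one sign only), and the staircase sums of the open sets
   {f > j/m} to continuous f with values in [0,1]. Since S1 belongs to the base, constants may be
   added with either sign, so the one-sided result holds for f and for -f. *)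

theory Submission
  imports Defs
begin

section \<open>Suprema, ramps, staircases and bases of balls\<close>

text \<open>Translates the \<open>ennreal\<close> suprema in the definitions of semi-uniform Feller
  kernels and of equicontinuity into bounds on reals that are uniform in the index. Non-strict
  bounds are enough, since a common bound on the terms bounds their supremum.\<close>

lemma tendsto_SUP_ennreal_0_iff:
  "((\<lambda>x. SUP i\<in>I. ennreal \<bar>g i x\<bar>) \<longlongrightarrow> 0) F \<longleftrightarrow>
    (\<forall>\<epsilon>>0. \<forall>\<^sub>F x in F. \<forall>i\<in>I. \<bar>g i x\<bar> \<le> \<epsilon>)"
proof
  assume L: "((\<lambda>x. SUP i\<in>I. ennreal \<bar>g i x\<bar>) \<longlongrightarrow> 0) F"
  show "\<forall>\<epsilon>>0. \<forall>\<^sub>F x in F. \<forall>i\<in>I. \<bar>g i x\<bar> \<le> \<epsilon>"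
  proof (intro allI impI)
    fix \<epsilon> :: real assume "\<epsilon> > 0"
    then have "\<forall>\<^sub>F x in F. (SUP i\<in>I. ennreal \<bar>g i x\<bar>) < ennreal \<epsilon>"
      by (intro order_tendstoD(2)[OF L]) simp
    then show "\<forall>\<^sub>F x in F. \<forall>i\<in>I. \<bar>g i x\<bar> \<le> \<epsilon>"
    proof eventually_elim
      case (elim x)
      show ?case
      proof
        fix i assume "i \<in> I"
        then have "ennreal \<bar>g i x\<bar> \<le> ennreal \<epsilon>"
          using elim by (meson SUP_upper le_less_trans less_imp_le)
        then show "\<bar>g i x\<bar> \<le> \<epsilon>"
          using \<open>\<epsilon> > 0\<close> by simp
      qed
    qed
  qed
next
  assume R: "\<forall>\<epsilon>>0. \<forall>\<^sub>F x in F. \<forall>i\<in>I. \<bar>g i x\<bar> \<le> \<epsilon>"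
  show "((\<lambda>x. SUP i\<in>I. ennreal \<bar>g i x\<bar>) \<longlongrightarrow> 0) F"
  proof (rule order_tendstoI)
    fix a :: ennreal assume "0 < a"
    \<comment> \<open>The threshold \<open>a\<close> may be infinite. A point strictly below it is
      finite, hence a real number, and it turns the non-strict bound on the supremum into a strict
      one.\<close>
    then obtain e where e: "0 < e" "e < a"
      using dense by blast
    have "e < top"
      using e(2) top_greatest by (rule order.strict_trans2)
    then obtain r where r: "e = ennreal r" "r > 0"
      using e by (cases e) (auto simp: less_le)
    have "\<forall>\<^sub>F x in F. \<forall>i\<in>I. \<bar>g i x\<bar> \<le> r"
      using R r by auto
    then show "\<forall>\<^sub>F x in F. (SUP i\<in>I. ennreal \<bar>g i x\<bar>) < a"
    proof eventually_elim
      case (elim x)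
      then have "(SUP i\<in>I. ennreal \<bar>g i x\<bar>) \<le> e"
        unfolding r by (auto intro!: SUP_least ennreal_leI)
      then show ?case using e by simp
    qed
  qed simp
qed

text \<open>For t \<noteq> 0 both ramps are saturated at the same value, 1 or 0 according to the
  sign of t, as soon as n |t| \<ge> 1. With t = r - dist d x this concentrates the gap between two
  continuous bounds for the indicator of a ball on its sphere.\<close>

lemma ramp_difference_tendsto:
  fixes t :: real
  shows "(\<lambda>n. max 0 (min 1 (1 + real n * t)) - max 0 (min 1 (real n * t)))
    \<longlonglongrightarrow> (if t = 0 then 1 else 0)"
proof (cases "t = 0")
  case False
  obtain N where N: "1 / \<bar>t\<bar> \<le> real N"
    using real_arch_simple by blast
  have "max 0 (min 1 (1 + real n * t)) - max 0 (min 1 (real n * t)) = 0" if "n \<ge> N" for n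
  proof -
    have "1 \<le> real N * \<bar>t\<bar>"
      using N False by (simp add: divide_simps)
    also have "\<dots> \<le> real n * \<bar>t\<bar>"
      using that by (intro mult_right_mono) auto
    finally show ?thesis by (auto simp: abs_if split: if_splits)
  qed
  then show ?thesis
    using False by (auto intro!: tendsto_eventually eventually_sequentiallyI[of N])
qed simp

text \<open>The sum counts the levels j/m strictly below y, and this count differs from m y by at
  most 1. It is the pointwise estimate for approximating a function by its superlevel sets.\<close>

lemma staircase_bounds:
  fixes y :: real
  assumes m: "m > 0" and y: "0 \<le> y" "y \<le> 1"
  defines "S \<equiv> 1 / real m * (\<Sum>j=1..m. of_bool (real j / real m < y))"
  shows "S \<le> y" "y \<le> S + 1 / real m"
proof -
  \<comment> \<open>The ceiling fits the strict inequality: j < m y holds exactly for the integers j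
    below it.\<close>
  define k where "k = nat \<lceil>real m * y\<rceil>"
  have k: "real_of_int \<lceil>real m * y\<rceil> = real k"
    using m y by (simp add: k_def)
  have "real m * y \<le> real m"
    using y by (simp add: mult_left_le)
  then have "\<lceil>real m * y\<rceil> \<le> int m"
    by (simp add: ceiling_le_iff)
  then have "k \<le> m" unfolding k_def nat_le_iff .
  have "real j / real m < y \<longleftrightarrow> j < k" for j
  proof -
    have "real j / real m < y \<longleftrightarrow> real j < real m * y"
      using m by (simp add: divide_less_eq mult.commute)
    also have "\<dots> \<longleftrightarrow> int j < \<lceil>real m * y\<rceil>"
      using less_ceiling_iff[of "int j" "real m * y"] by simp
    finally show ?thesis
      unfolding k_def zless_nat_eq_int_zless .
  qed
  then have "S = 1 / real m * (\<Sum>j=1..m. of_bool (j < k))"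
    unfolding S_def by (simp only:)
  \<comment> \<open>The levels start at 1, so k - 1 of them are counted. If y = 0 then k = 0, and
    the truncated difference is still the right count.\<close>
  moreover have "{1..m} \<inter> {j. j < k} = {1..<k}"
    using \<open>k \<le> m\<close> by auto
  ultimately have S: "S = real (k - 1) / real m"
    by simp
  have "real k - 1 < real m * y" "real m * y \<le> real k"
    using ceiling_correct[of "real m * y"] by (auto simp: k)
  then have "real (k - 1) \<le> real m * y" "real m * y \<le> real (k - 1) + 1"
    using y by (cases k; simp)+
  then show "S \<le> y" "y \<le> S + 1 / real m"
    using m unfolding S add_divide_distrib[symmetric]
    by (simp_all add: divide_le_eq le_divide_eq mult.commute)
qed

text \<open>Each radius is free within an open interval, which later leaves room to avoid bad radii.
  For the base property at x, choose n with 1/(n+1) < e/2 and a centre d closer to x than 1/(n+2):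
  the lower bound on the radius puts x into the ball, and the upper bound keeps the ball inside
  \<open>ball x e\<close>. The centres need not lie in S.\<close>

lemma countable_base_balls:
  fixes S :: "'a::metric_space set"
  assumes D: "countable D" "\<And>U. open U \<Longrightarrow> U \<noteq> {} \<Longrightarrow> \<exists>d\<in>D. d \<in> U"
    and r: "\<And>d n. r d n \<in> {inverse (real (n + 2))<..<inverse (real (n + 1))}"
  shows "countable_base (top_of_set S) (insert S ((\<lambda>(d, n :: nat). S \<inter> ball d (r d n)) ` (D \<times> UNIV)))"
    (is "countable_base _ ?\<tau>")
  unfolding countable_base_def
proof (intro conjI allI impI ballI)
  show "countable ?\<tau>" using D by auto
  show "openin (top_of_set S) U" if "U \<in> ?\<tau>" for U
    using that by (auto simp: openin_open_Int)
  fix U assume "openin (top_of_set S) U"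
  then obtain T where T: "open T" "U = S \<inter> T" by (auto simp: openin_open)
  have ex: "\<exists>V\<in>?\<tau>. x \<in> V \<and> V \<subseteq> U" if x: "x \<in> U" for x
  proof -
    obtain e where e: "e > 0" "ball x e \<subseteq> T"
      using T x by (auto simp: open_contains_ball)
    obtain n where n: "inverse (real (Suc n)) < e / 2"
      using reals_Archimedean[of "e / 2"] e by auto
    obtain d where d: "d \<in> D" "d \<in> ball x (inverse (real (n + 2)))"
      using D(2)[of "ball x (inverse (real (n + 2)))"] by auto
    have rd: "inverse (real (n + 2)) < r d n" "r d n < e / 2"
      using r[of d n] n by auto
    have "x \<in> ball d (r d n)"
      using d rd by (auto simp: dist_commute)
    moreover have "ball d (r d n) \<subseteq> ball x e"
    proof
      fix y assume "y \<in> ball d (r d n)"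
      then show "y \<in> ball x e"
        using dist_triangle[of x y d] d rd by auto
    qed
    ultimately show ?thesis
      using T x e d by (intro bexI[of _ "S \<inter> ball d (r d n)"]) auto
  qed
  have "\<Union>(?\<tau> \<inter> Pow U) = U"
  proof (intro equalityI subsetI)
    fix x assume "x \<in> U"
    then obtain V where "V \<in> ?\<tau>" "x \<in> V" "V \<subseteq> U"
      by (rule bexE[OF ex]) (erule conjE)
    then show "x \<in> \<Union>(?\<tau> \<inter> Pow U)"
      by (intro UnionI IntI PowI)
  qed (elim UnionE IntE PowD[THEN subsetD])
  then show "\<exists>\<U>\<subseteq>?\<tau>. \<Union>\<U> = U"
    by (intro exI[of _ "?\<tau> \<inter> Pow U"] conjI Int_lower1)
qed

section \<open>Projections, rectangles and integrals against slice measures\<close>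

lemma measurable_fst_borel_on:
  fixes S1 :: "'a::{metric_space,second_countable_topology} set"
    and S2 :: "'b::{metric_space,second_countable_topology} set"
  assumes M: "sets M = sets (borel_on (S1 \<times> S2))"
  shows "fst \<in> M \<rightarrow>\<^sub>M borel_on S1"
  unfolding measurable_cong_sets[OF M refl]
  by (intro measurable_restrict_space2 measurable_restrict_space1)
    (auto simp: space_restrict_space borel_measurable_continuous_onI continuous_on_fst)

lemma measurable_snd_borel_on:
  fixes S1 :: "'a::{metric_space,second_countable_topology} set"
    and S2 :: "'b::{metric_space,second_countable_topology} set"
  assumes M: "sets M = sets (borel_on (S1 \<times> S2))"
  shows "snd \<in> M \<rightarrow>\<^sub>M borel_on S2"
  unfolding measurable_cong_sets[OF M refl]
  by (intro measurable_restrict_space2 measurable_restrict_space1)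
    (auto simp: space_restrict_space borel_measurable_continuous_onI continuous_on_snd)

lemma times_sets_borel_on:
  fixes S1 :: "'a::{metric_space,second_countable_topology} set"
    and S2 :: "'b::{metric_space,second_countable_topology} set"
  assumes M: "sets M = sets (borel_on (S1 \<times> S2))"
    and A: "A \<in> sets (borel_on S1)" and B: "B \<in> sets (borel_on S2)"
  shows "A \<times> B \<in> sets M"
proof -
  have "space M = S1 \<times> S2"
    using sets_eq_imp_space_eq[OF M] by (simp add: space_restrict_space)
  then have "A \<times> B = (fst -` A \<inter> space M) \<inter> (snd -` B \<inter> space M)"
    using sets.sets_into_space[OF A] sets.sets_into_space[OF B]
    by (auto simp: space_restrict_space)
  then show ?thesis
    using measurable_sets[OF measurable_fst_borel_on[OF M] A]
      measurable_sets[OF measurable_snd_borel_on[OF M] B] by auto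
qed

text \<open>The slice measure is the image under \<open>fst\<close> of M weighted by the density
  1_B(s2). Integrals against it thus become integrals against the one measure M, whatever B
  is.\<close>

lemma integral_slice_measure:
  fixes M :: "('a::{metric_space,second_countable_topology} \<times>
                'b::{metric_space,second_countable_topology}) measure"
    and f :: "'a \<Rightarrow> real"
  assumes M: "sets M = sets (borel_on (S1 \<times> S2))"
    and B: "B \<in> sets (borel_on S2)" and f: "f \<in> borel_measurable (borel_on S1)"
  shows "(\<integral>x. f x \<partial>slice_measure S1 M B) = (\<integral>z. f (fst z) * indicator B (snd z) \<partial>M)"
proof -
  note fst = measurable_fst_borel_on[OF M]
  have ind: "(\<lambda>z. indicator B (snd z) :: real) \<in> borel_measurable M"
    using measurable_snd_borel_on[OF M] B by measurable
  have "slice_measure S1 M B = distr (density M (\<lambda>z. ennreal (indicator B (snd z)))) (borel_on S1) fst"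
  proof (rule measure_eqI)
    fix A assume "A \<in> sets (slice_measure S1 M B)"
    then have A: "A \<in> sets (borel_on S1)"
      by (simp add: sets_slice_measure)
    have AB: "fst -` A \<inter> space M \<in> sets M"
      using fst A by (rule measurable_sets)
    have "emeasure (distr (density M (\<lambda>z. ennreal (indicator B (snd z)))) (borel_on S1) fst) A
        = (\<integral>\<^sup>+z. ennreal (indicator B (snd z)) * indicator (fst -` A \<inter> space M) z \<partial>M)"
      using fst ind A AB by (simp add: emeasure_distr emeasure_density)
    also have "\<dots> = (\<integral>\<^sup>+z. indicator (A \<times> B) z \<partial>M)"
      by (intro nn_integral_cong) (auto simp: indicator_def split: if_splits)
    also have "\<dots> = emeasure M (A \<times> B)"
      using times_sets_borel_on[OF M A B] by simp
    finally show "emeasure (slice_measure S1 M B) A =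
        emeasure (distr (density M (\<lambda>z. ennreal (indicator B (snd z)))) (borel_on S1) fst) A"
      using emeasure_slice_measure[OF M B A] by simp
  qed (simp add: sets_slice_measure)
  then show ?thesis
    using fst f ind
    by (simp add: integral_distr integral_density mult.commute)
qed

section \<open>Slice integrals of bounded measurable functions\<close>

locale kernel =
  fixes S1 :: "'a::{metric_space,second_countable_topology} set"
    and S2 :: "'b::{metric_space,second_countable_topology} set"
    and S3 :: "'c::metric_space set"
    and \<Psi> :: "'c \<Rightarrow> ('a \<times> 'b) measure"
  assumes kernel: "stochastic_kernel S1 S2 S3 \<Psi>"
begin

text \<open>For bounded measurable f and Borel B this is the integral of f against \<Psi>(ds1, B |
  s), by \<open>integral_slice_measure\<close>. Written over the product, it can be compared for
  different B by monotonicity of the integrand.\<close>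

definition slice_integral :: "'c \<Rightarrow> ('a \<Rightarrow> real) \<Rightarrow> 'b set \<Rightarrow> real" where
  "slice_integral s f B = (\<integral>z. f (fst z) * indicator B (snd z) \<partial>\<Psi> s)"

definition bounded_measurable :: "('a \<Rightarrow> real) \<Rightarrow> bool" where
  "bounded_measurable f \<longleftrightarrow> f \<in> borel_measurable (borel_on S1) \<and> bounded (f ` S1)"

text \<open>Only the lower half of a two-sided estimate is required, because this half survives
  approximation from below. Bounded measurability is included so that the integrals at points of S3
  exist.\<close>

definition lsc_uniformly :: "'c \<Rightarrow> ('a \<Rightarrow> real) \<Rightarrow> bool" where
  "lsc_uniformly s f \<longleftrightarrow> bounded_measurable f \<and>
    (\<forall>\<epsilon>>0. \<forall>\<^sub>F s' in at s within S3. \<forall>B\<in>sets (borel_on S2).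
      slice_integral s f B - \<epsilon> \<le> slice_integral s' f B)"

lemma prob_space_kernel: "s \<in> S3 \<Longrightarrow> prob_space (\<Psi> s)"
  and sets_kernel: "s \<in> S3 \<Longrightarrow> sets (\<Psi> s) = sets (borel_on (S1 \<times> S2))"
  using kernel by (auto simp: stochastic_kernel_def)

lemma space_kernel: "s \<in> S3 \<Longrightarrow> space (\<Psi> s) = S1 \<times> S2"
  using sets_eq_imp_space_eq[OF sets_kernel] by (simp add: space_restrict_space)

lemmas fst_measurable_kernel = measurable_fst_borel_on[OF sets_kernel]

lemmas snd_measurable_kernel = measurable_snd_borel_on[OF sets_kernel]

lemmas times_sets_kernel = times_sets_borel_on[OF sets_kernel]

lemma whole_space_sets: "S2 \<in> sets (borel_on S2)" "S1 \<in> sets (borel_on S1)"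
  using sets.top[of "borel_on S2"] sets.top[of "borel_on S1"] by (auto simp: space_restrict_space)

lemma bounded_measurable_bound:
  assumes "bounded_measurable f"
  obtains c where "c > 0" "\<And>x. x \<in> S1 \<Longrightarrow> \<bar>f x\<bar> \<le> c"
  using assms unfolding bounded_measurable_def bounded_pos by auto

lemma bounded_measurableI:
  assumes "f \<in> borel_measurable (borel_on S1)" "\<And>x. x \<in> S1 \<Longrightarrow> \<bar>f x\<bar> \<le> c"
  shows "bounded_measurable f"
  using assms by (auto simp: bounded_measurable_def intro!: boundedI)

lemma bounded_measurable_add:
  assumes f: "bounded_measurable f" and g: "bounded_measurable g"
  shows "bounded_measurable (\<lambda>x. f x + g x)"
proof -
  obtain c d where "\<And>x. x \<in> S1 \<Longrightarrow> \<bar>f x\<bar> \<le> c" "\<And>x. x \<in> S1 \<Longrightarrow> \<bar>g x\<bar> \<le> d"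
    using bounded_measurable_bound[OF f] bounded_measurable_bound[OF g] by metis
  then have "\<bar>f x + g x\<bar> \<le> c + d" if "x \<in> S1" for x
    using that by (meson abs_triangle_ineq add_mono order_trans)
  then show ?thesis
    using f g by (intro bounded_measurableI) (auto simp: bounded_measurable_def)
qed

lemma bounded_measurable_cmult:
  assumes f: "bounded_measurable f"
  shows "bounded_measurable (\<lambda>x. c * f x)"
proof -
  obtain d where "\<And>x. x \<in> S1 \<Longrightarrow> \<bar>f x\<bar> \<le> d"
    using bounded_measurable_bound[OF f] by metis
  then have "\<bar>c * f x\<bar> \<le> \<bar>c\<bar> * d" if "x \<in> S1" for x
    using that by (simp add: abs_mult mult_left_mono)
  then show ?thesis
    using f by (intro bounded_measurableI) (auto simp: bounded_measurable_def)
qed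

lemma bounded_measurable_minus: "bounded_measurable f \<Longrightarrow> bounded_measurable (\<lambda>x. - f x)"
  using bounded_measurable_cmult[of f "-1"] by simp

lemma bounded_measurable_indicator:
  "A \<in> sets (borel_on S1) \<Longrightarrow> bounded_measurable (indicator A)"
  by (rule bounded_measurableI[where c = 1]) (auto simp: indicator_def)

lemma bounded_measurable_continuous:
  "continuous_on S1 f \<Longrightarrow> bounded (f ` S1) \<Longrightarrow> bounded_measurable f"
  by (simp add: bounded_measurable_def borel_measurable_continuous_on_restrict)

lemma integrable_slice:
  assumes s: "s \<in> S3" and B: "B \<in> sets (borel_on S2)" and f: "bounded_measurable f"
  shows "integrable (\<Psi> s) (\<lambda>z. f (fst z) * indicator B (snd z))"
proof -
  interpret prob_space "\<Psi> s" by (rule prob_space_kernel[OF s])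
  note [measurable] = fst_measurable_kernel[OF s] snd_measurable_kernel[OF s] B
  obtain c where c: "c > 0" "\<And>x. x \<in> S1 \<Longrightarrow> \<bar>f x\<bar> \<le> c"
    using bounded_measurable_bound[OF f] by metis
  have [measurable]: "f \<in> borel_measurable (borel_on S1)"
    using f by (simp add: bounded_measurable_def)
  show ?thesis
  proof (rule integrable_const_bound[where B = c])
    show "AE z in \<Psi> s. norm (f (fst z) * indicator B (snd z)) \<le> c"
      using c by (intro AE_I2) (auto simp: space_kernel[OF s] indicator_def)
  qed measurable
qed

lemma slice_integral_add:
  assumes "s \<in> S3" "B \<in> sets (borel_on S2)" "bounded_measurable f" "bounded_measurable g"
  shows "slice_integral s (\<lambda>x. f x + g x) B = slice_integral s f B + slice_integral s g B"
  unfolding slice_integral_def using integrable_slice[OF assms(1,2)] assms(3,4)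
  by (simp add: distrib_right)

lemma slice_integral_cmult: "slice_integral s (\<lambda>x. c * f x) B = c * slice_integral s f B"
  unfolding slice_integral_def by (simp add: mult.assoc)

lemma slice_integral_minus: "slice_integral s (\<lambda>x. - f x) B = - slice_integral s f B"
  using slice_integral_cmult[of s "-1"] by simp

lemma slice_integral_diff:
  assumes "s \<in> S3" "B \<in> sets (borel_on S2)" "bounded_measurable f" "bounded_measurable g"
  shows "slice_integral s (\<lambda>x. f x - g x) B = slice_integral s f B - slice_integral s g B"
  using slice_integral_add[OF assms(1-3) bounded_measurable_minus[OF assms(4)]]
  by (simp add: slice_integral_minus)

text \<open>The hypothesis compares products with indicators, so that one rule covers both f \<le> g
  on a fixed B and the enlargement of B to S2 under a nonnegative function.\<close>

lemma slice_integral_mono: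
  assumes "s \<in> S3" "B \<in> sets (borel_on S2)" "C \<in> sets (borel_on S2)"
    and "bounded_measurable f" "bounded_measurable g"
    and "\<And>x y. x \<in> S1 \<Longrightarrow> y \<in> S2 \<Longrightarrow> f x * indicator B y \<le> g x * indicator C y"
  shows "slice_integral s f B \<le> slice_integral s g C"
  unfolding slice_integral_def using assms
  by (intro integral_mono integrable_slice) (auto simp: space_kernel)

lemma slice_integral_cong:
  assumes "s \<in> S3" "\<And>x. x \<in> S1 \<Longrightarrow> f x = g x"
  shows "slice_integral s f B = slice_integral s g B"
  unfolding slice_integral_def using assms
  by (intro Bochner_Integration.integral_cong) (auto simp: space_kernel)

lemma slice_integral_indicator:
  assumes s: "s \<in> S3" and A: "A \<in> sets (borel_on S1)" and B: "B \<in> sets (borel_on S2)"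
  shows "slice_integral s (indicator A) B = measure (\<Psi> s) (A \<times> B)"
proof -
  have "slice_integral s (indicator A) B = (\<integral>z. indicator (A \<times> B) z \<partial>\<Psi> s)"
    unfolding slice_integral_def
    by (intro Bochner_Integration.integral_cong) (auto simp: indicator_def)
  also have "\<dots> = measure (\<Psi> s) (A \<times> B \<inter> space (\<Psi> s))"
    by simp
  also have "A \<times> B \<inter> space (\<Psi> s) = A \<times> B"
    using sets.sets_into_space[OF times_sets_kernel[OF assms]] by auto
  finally show ?thesis .
qed

section \<open>Closure properties of uniform lower semicontinuity\<close>

text \<open>The kernel is controlled only on S3; this supplies membership to the pointwise arguments
  about nearby s'.\<close>

lemma eventually_in_S3: "\<forall>\<^sub>F s' in at s within S3. s' \<in> S3"
  by (simp add: eventually_at_filter)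

lemma lsc_uniformly_cong:
  assumes s: "s \<in> S3" and f: "lsc_uniformly s f" and eq: "\<And>x. x \<in> S1 \<Longrightarrow> f x = g x"
  shows "lsc_uniformly s g"
proof -
  have "g \<in> borel_measurable (borel_on S1)"
    using f measurable_cong[of "borel_on S1" f g borel] eq
    by (simp add: lsc_uniformly_def bounded_measurable_def space_restrict_space)
  moreover have "g ` S1 = f ` S1" using eq by auto
  ultimately have bm: "bounded_measurable g"
    using f by (simp add: lsc_uniformly_def bounded_measurable_def)
  have "\<forall>\<^sub>F s' in at s within S3. \<forall>B\<in>sets (borel_on S2).
      slice_integral s g B - \<epsilon> \<le> slice_integral s' g B" if "\<epsilon> > 0" for \<epsilon>
  proof -
    have "\<forall>\<^sub>F s' in at s within S3. \<forall>B\<in>sets (borel_on S2).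
        slice_integral s f B - \<epsilon> \<le> slice_integral s' f B"
      using f that by (simp add: lsc_uniformly_def)
    with eventually_in_S3 show ?thesis
      by eventually_elim (use slice_integral_cong[OF _ eq] s in simp)
  qed
  with bm show ?thesis by (simp add: lsc_uniformly_def)
qed

lemma lsc_uniformly_add:
  assumes s: "s \<in> S3" and f: "lsc_uniformly s f" and g: "lsc_uniformly s g"
  shows "lsc_uniformly s (\<lambda>x. f x + g x)"
proof -
  have bm: "bounded_measurable f" "bounded_measurable g"
    using f g by (auto simp: lsc_uniformly_def)
  have "\<forall>\<^sub>F s' in at s within S3. \<forall>B\<in>sets (borel_on S2).
      slice_integral s (\<lambda>x. f x + g x) B - \<epsilon> \<le> slice_integral s' (\<lambda>x. f x + g x) B"
    if "\<epsilon> > 0" for \<epsilon>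
  proof -
    have "\<forall>\<^sub>F s' in at s within S3. \<forall>B\<in>sets (borel_on S2).
        slice_integral s f B - \<epsilon> / 2 \<le> slice_integral s' f B"
      and "\<forall>\<^sub>F s' in at s within S3. \<forall>B\<in>sets (borel_on S2).
        slice_integral s g B - \<epsilon> / 2 \<le> slice_integral s' g B"
      using f g half_gt_zero[OF that] unfolding lsc_uniformly_def by blast+
    with eventually_in_S3 show ?thesis
    proof eventually_elim
      case (elim s')
      show ?case
      proof
        fix B assume B: "B \<in> sets (borel_on S2)"
        show "slice_integral s (\<lambda>x. f x + g x) B - \<epsilon> \<le> slice_integral s' (\<lambda>x. f x + g x) B"
          using bspec[OF elim(2) B] bspec[OF elim(3) B]
            slice_integral_add[OF s B bm] slice_integral_add[OF elim(1) B bm] by simp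
      qed
    qed
  qed
  with bounded_measurable_add[OF bm] show ?thesis by (simp add: lsc_uniformly_def)
qed

lemma lsc_uniformly_0: "lsc_uniformly s (\<lambda>x. 0)"
  by (auto simp: lsc_uniformly_def slice_integral_def eventually_at_filter
      intro: bounded_measurableI[where c = 0])

lemma lsc_uniformly_sum:
  assumes "s \<in> S3" "finite J" "\<And>j. j \<in> J \<Longrightarrow> lsc_uniformly s (f j)"
  shows "lsc_uniformly s (\<lambda>x. \<Sum>j\<in>J. f j x)"
  using assms(2,3)
  by (induction J) (auto intro!: lsc_uniformly_0 lsc_uniformly_add[OF assms(1)])

lemma lsc_uniformly_cmult:
  assumes f: "lsc_uniformly s f" and c: "c \<ge> 0"
  shows "lsc_uniformly s (\<lambda>x. c * f x)"
proof (cases "c = 0")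
  case True
  then show ?thesis by (simp add: lsc_uniformly_0)
next
  case False
  then have c: "c > 0" using c by simp
  have "\<forall>\<^sub>F s' in at s within S3. \<forall>B\<in>sets (borel_on S2).
      slice_integral s (\<lambda>x. c * f x) B - \<epsilon> \<le> slice_integral s' (\<lambda>x. c * f x) B"
    if "\<epsilon> > 0" for \<epsilon>
  proof -
    have "\<forall>\<^sub>F s' in at s within S3. \<forall>B\<in>sets (borel_on S2).
        slice_integral s f B - \<epsilon> / c \<le> slice_integral s' f B"
      using f divide_pos_pos[OF that c] unfolding lsc_uniformly_def by blast
    then show ?thesis
      by eventually_elim (use c in \<open>auto simp: slice_integral_cmult field_simps\<close>)
  qed
  then show ?thesis
    using f by (simp add: lsc_uniformly_def bounded_measurable_cmult)
qed

text \<open>At s the loss from replacing f by g \<le> f is the integral of f - g \<ge> 0 over B,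
  which is largest for B = S2 and hence small uniformly in B. At s' only the inequality between g
  and f is used, so f - g needs no control away from s.\<close>

lemma lsc_uniformly_approx:
  assumes s: "s \<in> S3" and f: "bounded_measurable f"
    and ex: "\<And>\<epsilon>. \<epsilon> > 0 \<Longrightarrow> \<exists>g. lsc_uniformly s g \<and> (\<forall>x\<in>S1. g x \<le> f x) \<and>
      slice_integral s f S2 - \<epsilon> \<le> slice_integral s g S2"
  shows "lsc_uniformly s f"
proof -
  have "\<forall>\<^sub>F s' in at s within S3. \<forall>B\<in>sets (borel_on S2).
      slice_integral s f B - \<epsilon> \<le> slice_integral s' f B" if "\<epsilon> > 0" for \<epsilon>
  proof -
    have "\<epsilon> / 2 > 0" using that by simp
    from ex[OF this] obtain g where g: "lsc_uniformly s g" "\<And>x. x \<in> S1 \<Longrightarrow> g x \<le> f x"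
      "slice_integral s f S2 - \<epsilon> / 2 \<le> slice_integral s g S2"
      by blast
    have bg: "bounded_measurable g"
      using g by (simp add: lsc_uniformly_def)
    have bfg: "bounded_measurable (\<lambda>x. f x - g x)"
      using bounded_measurable_add[OF f bounded_measurable_minus[OF bg]] by simp
    have "\<forall>\<^sub>F s' in at s within S3. \<forall>B\<in>sets (borel_on S2).
        slice_integral s g B - \<epsilon> / 2 \<le> slice_integral s' g B"
      using g half_gt_zero[OF that] unfolding lsc_uniformly_def by blast
    with eventually_in_S3 show ?thesis
    proof eventually_elim
      case (elim s')
      show ?case
      proof
        fix B assume B: "B \<in> sets (borel_on S2)"
        have "slice_integral s (\<lambda>x. f x - g x) B \<le> slice_integral s (\<lambda>x. f x - g x) S2"
          using g by (intro slice_integral_mono[OF s B whole_space_sets(1) bfg bfg])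
            (auto simp: indicator_def)
        moreover have "slice_integral s' g B \<le> slice_integral s' f B"
          using g by (intro slice_integral_mono[OF elim(1) B B bg f]) (auto simp: indicator_def)
        ultimately show "slice_integral s f B - \<epsilon> \<le> slice_integral s' f B"
          using bspec[OF elim(2) B] g(3) slice_integral_diff[OF s B f bg]
            slice_integral_diff[OF s whole_space_sets(1) f bg] by simp
      qed
    qed
  qed
  with f show ?thesis by (simp add: lsc_uniformly_def)
qed

section \<open>Both sides of the equivalence as uniform lower semicontinuity\<close>

text \<open>By linearity the lower bound for -f is the upper bound for f, and the two halves make up
  the absolute value.\<close>

lemma lsc_uniformly_both_iff:
  assumes "bounded_measurable f"
  shows "lsc_uniformly s f \<and> lsc_uniformly s (\<lambda>x. - f x) \<longleftrightarrow>
    (\<forall>\<epsilon>>0. \<forall>\<^sub>F s' in at s within S3. \<forall>B\<in>sets (borel_on S2).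
      \<bar>slice_integral s' f B - slice_integral s f B\<bar> \<le> \<epsilon>)"
    (is "?L \<longleftrightarrow> ?R")
proof -
  have abs: "\<bar>b - a\<bar> \<le> \<epsilon> \<longleftrightarrow> a - \<epsilon> \<le> b \<and> - a - \<epsilon> \<le> - b" for a b \<epsilon> :: real
    by auto
  show ?thesis
    using assms bounded_measurable_minus[OF assms]
    unfolding lsc_uniformly_def abs ball_conj_distrib eventually_conj_iff slice_integral_minus
    by blast
qed

lemma equicontinuous_at_kernel_family_iff:
  assumes s: "s \<in> S3" and A: "A \<in> sets (borel_on S1)"
  shows "equicontinuous_at S3 s (kernel_family S2 \<Psi> A) \<longleftrightarrow>
    lsc_uniformly s (indicator A) \<and> lsc_uniformly s (\<lambda>x. - indicator A x)"
proof -
  have "kernel_family S2 \<Psi> A = (\<lambda>B s. measure (\<Psi> s) (A \<times> B)) ` sets (borel_on S2)"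
    by (auto simp: kernel_family_def)
  then have "equicontinuous_at S3 s (kernel_family S2 \<Psi> A) \<longleftrightarrow>
      (\<forall>\<epsilon>>0. \<forall>\<^sub>F s' in at s within S3. \<forall>B\<in>sets (borel_on S2).
        \<bar>measure (\<Psi> s') (A \<times> B) - measure (\<Psi> s) (A \<times> B)\<bar> \<le> \<epsilon>)"
    by (simp add: equicontinuous_at_def image_image tendsto_SUP_ennreal_0_iff)
  also have "\<dots> \<longleftrightarrow> (\<forall>\<epsilon>>0. \<forall>\<^sub>F s' in at s within S3. \<forall>B\<in>sets (borel_on S2).
      \<bar>slice_integral s' (indicator A) B - slice_integral s (indicator A) B\<bar> \<le> \<epsilon>)"
  \<comment> \<open>Measures of rectangles agree with slice integrals of indicators at points of S3,
    so the predicates are exchanged only eventually within S3.\<close>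
  proof (intro all_cong1 imp_cong refl eventually_cong)
    show "\<forall>\<^sub>F s' in at s within S3. s' \<in> S3" by (rule eventually_in_S3)
  qed (simp add: slice_integral_indicator[OF _ A] s)
  finally show ?thesis
    by (simp add: lsc_uniformly_both_iff[OF bounded_measurable_indicator[OF A]])
qed

text \<open>Sequential limits in a metric space determine limits within S3. One sign suffices on the
  right, since -f is bounded and continuous whenever f is.\<close>

lemma semi_uniform_Feller_iff:
  "semi_uniform_Feller S1 S2 S3 \<Psi> \<longleftrightarrow>
    (\<forall>s\<in>S3. \<forall>f. continuous_on S1 f \<longrightarrow> bounded (f ` S1) \<longrightarrow> lsc_uniformly s f)"
    (is "?L \<longleftrightarrow> ?R")
proof -
  have cv: "((\<lambda>n. SUP B\<in>sets (borel_on S2).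
        ennreal \<bar>(\<integral>x. f x \<partial>slice_measure S1 (\<Psi> (X n)) B) -
                 (\<integral>x. f x \<partial>slice_measure S1 (\<Psi> s) B)\<bar>) \<longlonglongrightarrow> 0) \<longleftrightarrow>
      (\<lambda>n. SUP B\<in>sets (borel_on S2).
        ennreal \<bar>slice_integral (X n) f B - slice_integral s f B\<bar>) \<longlonglongrightarrow> 0"
    if f: "continuous_on S1 f" and X: "\<And>n. X n \<in> S3" and s: "s \<in> S3" for f and X :: "nat \<Rightarrow> 'c" and s
    using integral_slice_measure[OF sets_kernel _ borel_measurable_continuous_on_restrict[OF f]] X s
    by (simp add: slice_integral_def)
  show ?thesis
  proof
    assume L: ?L
    show ?R
    proof (intro ballI allI impI)
      fix s and f :: "'a \<Rightarrow> real"
      assume s: "s \<in> S3" and f: "continuous_on S1 f" "bounded (f ` S1)"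
      \<comment> \<open>The sequences that test a limit at s avoid s itself; they are among those in
        the definition, so the hypothesis applies to each of them.\<close>
      have "((\<lambda>s'. SUP B\<in>sets (borel_on S2).
          ennreal \<bar>slice_integral s' f B - slice_integral s f B\<bar>) \<longlongrightarrow> 0) (at s within S3)"
        unfolding tendsto_at_iff_sequentially comp_def
      proof (intro allI impI)
        fix X assume X: "\<forall>i. X i \<in> S3 - {s}" "X \<longlonglongrightarrow> s"
        show "(\<lambda>n. SUP B\<in>sets (borel_on S2).
            ennreal \<bar>slice_integral (X n) f B - slice_integral s f B\<bar>) \<longlonglongrightarrow> 0"
          using L X s f cv[OF f(1) _ s, of X] unfolding semi_uniform_Feller_def by blast
      qed
      then show "lsc_uniformly s f"
        unfolding tendsto_SUP_ennreal_0_iff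
          lsc_uniformly_both_iff[OF bounded_measurable_continuous[OF f], symmetric]
        by (rule conjunct1)
    qed
  next
    assume R: ?R
    show ?L
      unfolding semi_uniform_Feller_def
    proof (intro allI impI)
      fix X s and f :: "'a \<Rightarrow> real"
      assume X: "\<forall>n. X n \<in> S3" "X \<longlonglongrightarrow> s" and s: "s \<in> S3"
        and f: "continuous_on S1 f" "bounded (f ` S1)"
      have "continuous_on S1 (\<lambda>x. - f x)" "bounded ((\<lambda>x. - f x) ` S1)"
        using f by (auto intro: continuous_on_minus simp: bounded_iff)
      then have "lsc_uniformly s f \<and> lsc_uniformly s (\<lambda>x. - f x)"
        using R s f by blast
      then have *: "\<forall>\<epsilon>>0. \<forall>\<^sub>F s' in at s within S3. \<forall>B\<in>sets (borel_on S2).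
          \<bar>slice_integral s' f B - slice_integral s f B\<bar> \<le> \<epsilon>"
        by (simp add: lsc_uniformly_both_iff[OF bounded_measurable_continuous[OF f]])
      have "\<forall>\<epsilon>>0. \<forall>\<^sub>F n in sequentially. \<forall>B\<in>sets (borel_on S2).
          \<bar>slice_integral (X n) f B - slice_integral s f B\<bar> \<le> \<epsilon>"
      proof (intro allI impI)
        fix \<epsilon> :: real assume e: "\<epsilon> > 0"
        obtain d where d: "d > 0" "\<And>s'. s' \<in> S3 \<Longrightarrow> s' \<noteq> s \<Longrightarrow> dist s' s < d \<Longrightarrow>
            \<forall>B\<in>sets (borel_on S2). \<bar>slice_integral s' f B - slice_integral s f B\<bar> \<le> \<epsilon>"
          using * e unfolding eventually_at by blast
        have "\<forall>\<^sub>F n in sequentially. dist (X n) s < d"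
          using X(2) d(1) by (rule tendstoD)
        then show "\<forall>\<^sub>F n in sequentially. \<forall>B\<in>sets (borel_on S2).
            \<bar>slice_integral (X n) f B - slice_integral s f B\<bar> \<le> \<epsilon>"
        proof eventually_elim
          case (elim n)
          \<comment> \<open>A sequence in the definition may hit s, which the punctured
            neighbourhood does not cover; there the difference is 0.\<close>
          then show ?case using d(2)[of "X n"] X(1) e by (cases "X n = s") auto
        qed
      qed
      then show "(\<lambda>n. SUP B\<in>sets (borel_on S2).
          ennreal \<bar>(\<integral>x. f x \<partial>slice_measure S1 (\<Psi> (X n)) B) -
                   (\<integral>x. f x \<partial>slice_measure S1 (\<Psi> s) B)\<bar>) \<longlonglongrightarrow> 0"
        using cv[OF f(1) _ s, of X] X(1) by (simp add: tendsto_SUP_ennreal_0_iff)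
    qed
  qed
qed

section \<open>Continuity sets of the marginal and balls with null spheres\<close>

lemma slice_integral_const:
  assumes s: "s \<in> S3"
  shows "slice_integral s (\<lambda>_. c) S2 = c"
proof -
  interpret prob_space "\<Psi> s" by (rule prob_space_kernel[OF s])
  have "slice_integral s (\<lambda>_. c) S2 = slice_integral s (\<lambda>x. c * indicator S1 x) S2"
    by (rule slice_integral_cong[OF s]) simp
  also have "\<dots> = c"
    using prob_space
    by (simp add: slice_integral_cmult slice_integral_indicator[OF s] whole_space_sets space_kernel[OF s])
  finally show ?thesis .
qed

text \<open>
  Equivalent to a null relative boundary under the marginal at \<open>s\<close>; in this form the sets are
  stable under intersection by multiplying the bounds.
\<close>

definition continuity_set :: "'c \<Rightarrow> 'a set \<Rightarrow> bool" where
  "continuity_set s A \<longleftrightarrow> A \<in> sets (borel_on S1) \<and>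
    (\<forall>\<epsilon>>0. \<exists>f g. continuous_on S1 f \<and> continuous_on S1 g \<and>
      (\<forall>x\<in>S1. 0 \<le> f x \<and> f x \<le> indicator A x \<and> indicator A x \<le> g x \<and> g x \<le> 1) \<and>
      slice_integral s (\<lambda>x. g x - f x) S2 \<le> \<epsilon>)"

lemma bounded_measurable_unit_interval:
  assumes "continuous_on S1 f" "\<And>x. x \<in> S1 \<Longrightarrow> 0 \<le> f x \<and> f x \<le> 1"
  shows "bounded_measurable f" "bounded (f ` S1)"
  using assms
  by (auto intro!: bounded_measurableI[where c = 1] boundedI[where B = 1]
      borel_measurable_continuous_on_restrict)

lemma continuity_set_whole: "s \<in> S3 \<Longrightarrow> continuity_set s S1"
  unfolding continuity_set_def using whole_space_sets slice_integral_const[of s 0]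
  by (auto intro!: exI[where x = "\<lambda>_. 1"])

lemma continuity_set_Int:
  assumes s: "s \<in> S3" and A: "continuity_set s A" and B: "continuity_set s B"
  shows "continuity_set s (A \<inter> B)"
  unfolding continuity_set_def
proof (intro conjI allI impI)
  show "A \<inter> B \<in> sets (borel_on S1)"
    using A B by (auto simp: continuity_set_def)
  fix \<epsilon> :: real assume "\<epsilon> > 0"
  then have e: "\<epsilon> / 2 > 0" by simp
  obtain f g where f: "continuous_on S1 f" and g: "continuous_on S1 g"
    and fg: "\<And>x. x \<in> S1 \<Longrightarrow> 0 \<le> f x \<and> f x \<le> indicator A x \<and> indicator A x \<le> g x \<and> g x \<le> 1"
    and ifg: "slice_integral s (\<lambda>x. g x - f x) S2 \<le> \<epsilon> / 2"
    using A e unfolding continuity_set_def by blast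
  obtain h k where h: "continuous_on S1 h" and k: "continuous_on S1 k"
    and hk: "\<And>x. x \<in> S1 \<Longrightarrow> 0 \<le> h x \<and> h x \<le> indicator B x \<and> indicator B x \<le> k x \<and> k x \<le> 1"
    and ihk: "slice_integral s (\<lambda>x. k x - h x) S2 \<le> \<epsilon> / 2"
    using B e unfolding continuity_set_def by blast
  have d1: "0 \<le> g x - f x \<and> g x - f x \<le> 1" "0 \<le> k x - h x \<and> k x - h x \<le> 1" if "x \<in> S1" for x
    using fg[OF that] hk[OF that] by linarith+
  have cont: "continuous_on S1 (\<lambda>x. g x - f x)" "continuous_on S1 (\<lambda>x. k x - h x)"
    using f g h k by (auto intro: continuous_on_diff)
  \<comment> \<open>The gap between the products splits as g (k - h) + (g - f) h. Since g and h are
    at most 1, it is at most the sum of the two gaps.\<close>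
  have diff: "g x * k x - f x * h x \<le> (g x - f x) + (k x - h x) \<and> 0 \<le> f x * h x \<and> g x * k x \<le> 1
      \<and> f x * h x \<le> g x * k x" if x: "x \<in> S1" for x
  proof -
    note b = fg[OF x] hk[OF x] d1[OF x]
    have "h x \<le> 1"
      using b by (auto simp: indicator_def split: if_splits)
    then have "g x * (k x - h x) \<le> 1 * (k x - h x)" "(g x - f x) * h x \<le> (g x - f x) * 1"
      using b by (intro mult_right_mono mult_left_mono; simp)+
    moreover have "g x * k x - f x * h x = g x * (k x - h x) + (g x - f x) * h x"
      by (simp add: algebra_simps)
    moreover have "f x * h x \<le> g x * k x"
      using b by (intro mult_mono) auto
    moreover have "g x * k x \<le> 1"
      using b by (intro mult_le_one) auto
    ultimately show ?thesis using b by simp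
  qed
  have cp: "continuous_on S1 (\<lambda>x. f x * h x)" "continuous_on S1 (\<lambda>x. g x * k x)"
    using f g h k by (auto intro: continuous_on_mult)
  have ib: "f x * h x \<le> indicator (A \<inter> B) x" "indicator (A \<inter> B) x \<le> g x * k x" if x: "x \<in> S1" for x
  proof -
    have "f x * h x \<le> indicator A x * indicator B x" "indicator A x * indicator B x \<le> g x * k x"
      using fg[OF x] hk[OF x] by (auto intro!: mult_mono)
    then show "f x * h x \<le> indicator (A \<inter> B) x" "indicator (A \<inter> B) x \<le> g x * k x"
      by (auto simp: indicator_inter_arith)
  qed
  have "slice_integral s (\<lambda>x. g x * k x - f x * h x) S2
      \<le> slice_integral s (\<lambda>x. (g x - f x) + (k x - h x)) S2"
  proof (rule slice_integral_mono[OF s whole_space_sets(1) whole_space_sets(1)])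
    have "0 \<le> g x * k x - f x * h x \<and> g x * k x - f x * h x \<le> 1" if "x \<in> S1" for x
      using diff[OF that] by linarith
    then show "bounded_measurable (\<lambda>x. g x * k x - f x * h x)"
      by (intro bounded_measurable_unit_interval continuous_on_diff cp) auto
    show "bounded_measurable (\<lambda>x. (g x - f x) + (k x - h x))"
      using d1 by (intro bounded_measurable_add bounded_measurable_unit_interval cont) auto
  qed (use diff in \<open>auto simp: indicator_def\<close>)
  also have "\<dots> = slice_integral s (\<lambda>x. g x - f x) S2 + slice_integral s (\<lambda>x. k x - h x) S2"
    using d1 by (intro slice_integral_add s whole_space_sets bounded_measurable_unit_interval cont) auto
  also have "\<dots> \<le> \<epsilon>" using ifg ihk by simp
  finally show "\<exists>f g. continuous_on S1 f \<and> continuous_on S1 g \<and>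
      (\<forall>x\<in>S1. 0 \<le> f x \<and> f x \<le> indicator (A \<inter> B) x \<and> indicator (A \<inter> B) x \<le> g x \<and> g x \<le> 1) \<and>
      slice_integral s (\<lambda>x. g x - f x) S2 \<le> \<epsilon>"
    using cp diff ib by (intro exI[of _ "\<lambda>x. f x * h x"] exI[of _ "\<lambda>x. g x * k x"]) auto
qed

lemma continuity_set_INT:
  assumes "s \<in> S3" "finite J" "J \<noteq> {}" "\<And>j. j \<in> J \<Longrightarrow> continuity_set s (A j)"
  shows "continuity_set s (\<Inter>j\<in>J. A j)"
  using assms(2-) by (induction J rule: finite_ne_induct) (auto intro: continuity_set_Int[OF assms(1)])

text \<open>The continuous minorant approximates the indicator from below, and the negated majorant
  approximates the negated indicator from below. The hypothesis covers both, so
  \<open>lsc_uniformly_approx\<close> gives both signs.\<close>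

lemma continuity_set_lsc_uniformly:
  assumes s: "s \<in> S3" and A: "continuity_set s A"
    and cont: "\<And>f. continuous_on S1 f \<Longrightarrow> bounded (f ` S1) \<Longrightarrow> lsc_uniformly s f"
  shows "lsc_uniformly s (indicator A)" "lsc_uniformly s (\<lambda>x. - indicator A x)"
proof -
  have bA: "bounded_measurable (indicator A)"
    using A by (auto simp: continuity_set_def bounded_measurable_indicator)
  have *: "\<exists>f g. lsc_uniformly s f \<and> lsc_uniformly s (\<lambda>x. - g x) \<and>
      (\<forall>x\<in>S1. f x \<le> indicator A x \<and> indicator A x \<le> g x) \<and>
      slice_integral s (indicator A) S2 - \<epsilon> \<le> slice_integral s f S2 \<and>
      slice_integral s g S2 \<le> slice_integral s (indicator A) S2 + \<epsilon>" if e: "\<epsilon> > 0" for \<epsilon>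
  proof -
    obtain f g where f: "continuous_on S1 f" and g: "continuous_on S1 g"
      and fg: "\<And>x. x \<in> S1 \<Longrightarrow> 0 \<le> f x \<and> f x \<le> indicator A x \<and> indicator A x \<le> g x \<and> g x \<le> 1"
      and ifg: "slice_integral s (\<lambda>x. g x - f x) S2 \<le> \<epsilon>"
      using A e unfolding continuity_set_def by blast
    have u: "0 \<le> f x \<and> f x \<le> 1" "0 \<le> g x \<and> g x \<le> 1" if "x \<in> S1" for x
      using fg[OF that] by (auto simp: indicator_def split: if_splits)
    note bf = bounded_measurable_unit_interval[OF f u(1)]
      and bg = bounded_measurable_unit_interval[OF g u(2)]
    have "slice_integral s f S2 \<le> slice_integral s (indicator A) S2"
      "slice_integral s (indicator A) S2 \<le> slice_integral s g S2"
      using fg by (auto intro!: slice_integral_mono[OF s] whole_space_sets bf bg bA)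
    moreover have "slice_integral s g S2 - slice_integral s f S2 \<le> \<epsilon>"
      using ifg slice_integral_diff[OF s whole_space_sets(1) bg(1) bf(1)] by simp
    moreover have "lsc_uniformly s f"
      using f bf by (intro cont)
    moreover have "lsc_uniformly s (\<lambda>x. - g x)"
      using g bg by (intro cont continuous_on_minus) (auto simp: bounded_iff)
    ultimately show ?thesis using fg by (intro exI[of _ f] exI[of _ g]) auto
  qed
  show "lsc_uniformly s (indicator A)"
    using * by (intro lsc_uniformly_approx[OF s bA]) blast
  show "lsc_uniformly s (\<lambda>x. - indicator A x)"
  proof (rule lsc_uniformly_approx[OF s bounded_measurable_minus[OF bA]])
    fix \<epsilon> :: real assume "\<epsilon> > 0"
    from *[OF this] obtain g where "lsc_uniformly s (\<lambda>x. - g x)" "\<forall>x\<in>S1. indicator A x \<le> g x"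
      "slice_integral s g S2 \<le> slice_integral s (indicator A) S2 + \<epsilon>" by blast
    then show "\<exists>g. lsc_uniformly s g \<and> (\<forall>x\<in>S1. g x \<le> - indicator A x) \<and>
        slice_integral s (\<lambda>x. - indicator A x) S2 - \<epsilon> \<le> slice_integral s g S2"
      by (intro exI[of _ "\<lambda>x. - g x"]) (auto simp: slice_integral_minus)
  qed
qed

lemma open_Int_sets_borel_on: "open U \<Longrightarrow> S1 \<inter> U \<in> sets (borel_on S1)"
  by (auto simp: sets_restrict_space)

lemma closed_Int_sets_borel_on: "closed U \<Longrightarrow> S1 \<inter> U \<in> sets (borel_on S1)"
  by (auto simp: sets_restrict_space)

text \<open>Continuous ramps enclose the indicator of the ball, and their gap tends to the indicator
  of the sphere. By dominated convergence the integral of the gap tends to the mass of the sphere,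
  which is 0.\<close>

lemma continuity_set_ball:
  assumes s: "s \<in> S3" and null: "measure (\<Psi> s) ((S1 \<inter> sphere d r) \<times> S2) = 0"
  shows "continuity_set s (S1 \<inter> ball d r)"
  unfolding continuity_set_def
proof (intro conjI allI impI)
  interpret prob_space "\<Psi> s" by (rule prob_space_kernel[OF s])
  show "S1 \<inter> ball d r \<in> sets (borel_on S1)"
    by (rule open_Int_sets_borel_on) simp
  fix \<epsilon> :: real assume e: "\<epsilon> > 0"
  \<comment> \<open>Both ramps have slope n in the distance to d: \<open>f n\<close> climbs from 0
    at the sphere to 1 inside the ball, while \<open>g n\<close> is 1 on the closed ball and falls
    to 0 outside.\<close>
  define f where "f n x = max 0 (min 1 (real n * (r - dist d x)))" for n x
  define g where "g n x = max 0 (min 1 (1 + real n * (r - dist d x)))" for n x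
  have cont: "continuous_on S1 (f n)" "continuous_on S1 (g n)" for n
    unfolding f_def g_def by (intro continuous_intros)+
  have le: "0 \<le> f n x \<and> f n x \<le> indicator (S1 \<inter> ball d r) x \<and>
      indicator (S1 \<inter> ball d r) x \<le> g n x \<and> g n x \<le> 1" if "x \<in> S1" for n x
    using that mult_nonneg_nonpos[of "real n" "r - dist d x"]
      mult_nonneg_nonneg[of "real n" "r - dist d x"]
    by (auto simp: f_def g_def indicator_def)
  have diff: "0 \<le> g n x - f n x \<and> g n x - f n x \<le> 1" for n x
    by (auto simp: f_def g_def)
  have bm: "bounded_measurable (\<lambda>x. g n x - f n x)" for n
    by (intro bounded_measurable_unit_interval continuous_on_diff cont diff)
  have S: "S1 \<inter> sphere d r \<in> sets (borel_on S1)"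
    unfolding sphere_def by (intro closed_Int_sets_borel_on closed_Collect_eq continuous_intros)
  have "(\<lambda>n. slice_integral s (\<lambda>x. g n x - f n x) S2)
      \<longlonglongrightarrow> slice_integral s (indicator (S1 \<inter> sphere d r)) S2"
    unfolding slice_integral_def
  proof (rule integral_dominated_convergence[where w = "\<lambda>_. 1"])
    show "(\<lambda>z. indicat_real (S1 \<inter> sphere d r) (fst z) * indicator S2 (snd z)) \<in> borel_measurable (\<Psi> s)"
      by (rule borel_measurable_integrable[OF integrable_slice[OF s whole_space_sets(1)
            bounded_measurable_indicator[OF S]]])
    show "(\<lambda>z. (g n (fst z) - f n (fst z)) * indicator S2 (snd z)) \<in> borel_measurable (\<Psi> s)" for n
      by (rule borel_measurable_integrable[OF integrable_slice[OF s whole_space_sets(1) bm]])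
    show "AE z in \<Psi> s. norm ((g n (fst z) - f n (fst z)) * indicator S2 (snd z)) \<le> 1" for n
      using diff by (auto simp: indicator_def)
    have "(\<lambda>n. g n x - f n x) \<longlonglongrightarrow> indicator (S1 \<inter> sphere d r) x" if x: "x \<in> S1" for x
    proof -
      have "indicator (S1 \<inter> sphere d r) x = (if r - dist d x = 0 then 1 else 0 :: real)"
        using x by (auto simp: indicator_def)
      then show ?thesis
        unfolding f_def g_def using ramp_difference_tendsto[of "r - dist d x"] by simp
    qed
    then show "AE z in \<Psi> s. (\<lambda>n. (g n (fst z) - f n (fst z)) * indicator S2 (snd z))
        \<longlonglongrightarrow> indicat_real (S1 \<inter> sphere d r) (fst z) * indicator S2 (snd z)"
      by (intro AE_I2 tendsto_mult_right) (auto simp: space_kernel[OF s])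
  qed simp
  also have "slice_integral s (indicator (S1 \<inter> sphere d r)) S2 = 0"
    using null by (simp add: slice_integral_indicator[OF s S whole_space_sets(1)])
  finally have "\<forall>\<^sub>F n in sequentially. slice_integral s (\<lambda>x. g n x - f n x) S2 < \<epsilon>"
    using e by (rule order_tendstoD)
  then obtain n where "slice_integral s (\<lambda>x. g n x - f n x) S2 < \<epsilon>"
    by (auto simp: eventually_sequentially)
  then show "\<exists>f g. continuous_on S1 f \<and> continuous_on S1 g \<and>
      (\<forall>x\<in>S1. 0 \<le> f x \<and> f x \<le> indicator (S1 \<inter> ball d r) x \<and>
        indicator (S1 \<inter> ball d r) x \<le> g x \<and> g x \<le> 1) \<and>
      slice_integral s (\<lambda>x. g x - f x) S2 \<le> \<epsilon>"
    using cont le by (intro exI[of _ "f n"] exI[of _ "g n"]) auto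
qed

text \<open>Sphere masses are the point masses of the law of the distance to d, and a probability
  measure on the line has only countably many atoms.\<close>

lemma countable_charged_spheres:
  assumes s: "s \<in> S3"
  shows "countable {r. measure (\<Psi> s) ((S1 \<inter> sphere d r) \<times> S2) \<noteq> 0}"
proof -
  interpret prob_space "\<Psi> s" by (rule prob_space_kernel[OF s])
  have m: "(\<lambda>z. dist d (fst z)) \<in> borel_measurable (\<Psi> s)"
    by (rule measurable_compose[OF fst_measurable_kernel[OF s]])
      (intro borel_measurable_continuous_on_restrict continuous_intros)
  interpret D: prob_space "distr (\<Psi> s) borel (\<lambda>z. dist d (fst z))"
    by (rule prob_space_distr[OF m])
  have "measure (distr (\<Psi> s) borel (\<lambda>z. dist d (fst z))) {r} =
      measure (\<Psi> s) ((S1 \<inter> sphere d r) \<times> S2)" for r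
    by (subst measure_distr[OF m]) (auto simp: space_kernel[OF s] intro!: arg_cong[where f = "measure (\<Psi> s)"])
  then show ?thesis using D.countable_support by simp
qed

section \<open>From finite intersections of base sets to continuous functions\<close>

text \<open>Inclusion-exclusion by induction on \<open>\<V>\<close>. The extra intersection over
  \<open>\<F>\<close> makes the induction close: the overlap of the new set V with the old union is
  the same expression with V added to \<open>\<F>\<close>. The overlap is subtracted, so both signs
  are carried along.\<close>

lemma lsc_uniformly_Union_Int_Inter:
  assumes s: "s \<in> S3" and \<tau>: "\<tau> \<subseteq> sets (borel_on S1)"
    and Inter: "\<And>\<F>. finite \<F> \<Longrightarrow> \<F> \<noteq> {} \<Longrightarrow> \<F> \<subseteq> \<tau> \<Longrightarrow>
      lsc_uniformly s (indicator (\<Inter>\<F>)) \<and> lsc_uniformly s (\<lambda>x. - indicator (\<Inter>\<F>) x)"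
    and \<V>: "finite \<V>" "\<V> \<subseteq> \<tau>" and \<F>: "finite \<F>" "\<F> \<noteq> {}" "\<F> \<subseteq> \<tau>"
  shows "lsc_uniformly s (indicator (\<Union>\<V> \<inter> \<Inter>\<F>)) \<and>
    lsc_uniformly s (\<lambda>x. - indicator (\<Union>\<V> \<inter> \<Inter>\<F>) x)"
  using \<V> \<F>
proof (induction \<V> arbitrary: \<F>)
  case empty
  have "indicator {} = (\<lambda>x::'a. 0 :: real)" by auto
  then show ?case using lsc_uniformly_0 by simp
next
  case (insert V \<V>)
  let ?W = "\<Union>\<V> \<inter> \<Inter>\<F>" and ?V = "\<Inter>(insert V \<F>)" and ?X = "\<Union>\<V> \<inter> \<Inter>(insert V \<F>)"
  have W: "lsc_uniformly s (indicator ?W)" "lsc_uniformly s (\<lambda>x. - indicator ?W x)"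
    using insert.IH[of \<F>] insert.prems by auto
  have V: "lsc_uniformly s (indicator ?V)" "lsc_uniformly s (\<lambda>x. - indicator ?V x)"
    using Inter[of "insert V \<F>"] insert.prems by auto
  have X: "lsc_uniformly s (indicator ?X)" "lsc_uniformly s (\<lambda>x. - indicator ?X x)"
    using insert.IH[of "insert V \<F>"] insert.prems by auto
  have "indicator (\<Union>(insert V \<V>) \<inter> \<Inter>\<F>) = (\<lambda>x. indicator ?W x + indicator ?V x + - indicator ?X x :: real)"
    "(\<lambda>x. - indicator (\<Union>(insert V \<V>) \<inter> \<Inter>\<F>) x) =
      (\<lambda>x. - indicator ?W x + - indicator ?V x + indicator ?X x :: real)"
    by (auto simp: indicator_def fun_eq_iff)
  then show ?case
    by (simp only:) (intro conjI lsc_uniformly_add[OF s] W V X)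
qed

text \<open>An open set is a countable union of base sets, and its finite partial unions exhaust it
  in the marginal at s by continuity from below. The approximation is from below only, so one sign
  is obtained.\<close>

lemma lsc_uniformly_open:
  assumes s: "s \<in> S3" and base: "countable_base (top_of_set S1) \<tau>"
    and fin: "\<And>\<V>. finite \<V> \<Longrightarrow> \<V> \<subseteq> \<tau> \<Longrightarrow> lsc_uniformly s (indicator (\<Union>\<V>))"
    and G: "openin (top_of_set S1) G"
  shows "lsc_uniformly s (indicator G)"
proof -
  interpret prob_space "\<Psi> s" by (rule prob_space_kernel[OF s])
  have sets: "U \<in> sets (borel_on S1)" if "openin (top_of_set S1) U" for U
    using that by (auto simp: openin_open open_Int_sets_borel_on)
  obtain \<U> where \<U>: "\<U> \<subseteq> \<tau>" "\<Union>\<U> = G"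
    using base G unfolding countable_base_def by blast
  have c\<U>: "countable \<U>"
    using \<U> base by (auto simp: countable_base_def intro: countable_subset)
  show ?thesis
  \<comment> \<open>The enumeration \<open>from_nat_into\<close> needs a nonempty family. An empty
    one means that G is empty, which is the empty finite union.\<close>
  proof (cases "\<U> = {}")
    case True
    then show ?thesis using fin[of "{}"] \<U> by simp
  next
    case False
    define V where "V n = \<Union>(from_nat_into \<U> ` {..n})" for n
    have sub: "from_nat_into \<U> ` {..n} \<subseteq> \<U>" for n
      using from_nat_into[OF False] by auto
    have lV: "lsc_uniformly s (indicator (V n))" for n
      unfolding V_def using sub \<U> by (intro fin) auto
    have "openin (top_of_set S1) (V n)" for n
      unfolding V_def using sub \<U> base by (intro openin_Union) (auto simp: countable_base_def)
    then have Vs: "V n \<in> sets (borel_on S1)" for n by (rule sets)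
    have incV: "V m \<subseteq> V n" if "m \<le> n" for m n
      unfolding V_def using that by (intro Union_mono image_mono) auto
    have "(\<Union>n. V n) = \<Union>(range (from_nat_into \<U>))"
      by (auto simp: V_def)
    then have UV: "(\<Union>n. V n \<times> S2) = G \<times> S2"
      using \<U> False c\<U> by (simp add: range_from_nat_into flip: Sigma_Union) auto
    have "(\<lambda>n. measure (\<Psi> s) (V n \<times> S2)) \<longlonglongrightarrow> measure (\<Psi> s) (\<Union>n. V n \<times> S2)"
      by (rule finite_Lim_measure_incseq)
        (use times_sets_kernel[OF s Vs whole_space_sets(1)] incV in \<open>auto simp: incseq_def\<close>)
    then have lim: "(\<lambda>n. slice_integral s (indicator (V n)) S2) \<longlonglongrightarrow> slice_integral s (indicator G) S2"
      by (simp add: slice_integral_indicator[OF s] Vs sets[OF G] whole_space_sets UV)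
    show ?thesis
    proof (rule lsc_uniformly_approx[OF s bounded_measurable_indicator[OF sets[OF G]]])
      fix \<epsilon> :: real assume "\<epsilon> > 0"
      then have "\<forall>\<^sub>F n in sequentially. slice_integral s (indicator G) S2 - \<epsilon> < slice_integral s (indicator (V n)) S2"
        by (intro order_tendstoD(1)[OF lim]) simp
      then obtain n where n: "slice_integral s (indicator G) S2 - \<epsilon> < slice_integral s (indicator (V n)) S2"
        by (auto simp: eventually_sequentially)
      have "V n \<subseteq> G" unfolding V_def using sub \<U> by blast
      then have "\<forall>x\<in>S1. indicat_real (V n) x \<le> indicator G x"
        by (auto simp: indicator_def)
      with lV[of n] n show "\<exists>g. lsc_uniformly s g \<and> (\<forall>x\<in>S1. g x \<le> indicat_real G x) \<and>
          slice_integral s (indicator G) S2 - \<epsilon> \<le> slice_integral s g S2"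
        by (intro exI[of _ "indicator (V n)"]) auto
    qed
  qed
qed

text \<open>Strict superlevel sets of f are open in S1, so their staircase sum inherits the property
  with nonnegative weights. It lies below f by at most 1/m, and since \<Psi>(. | s) has mass 1, so
  does its integral.\<close>

lemma lsc_uniformly_unit_interval:
  assumes s: "s \<in> S3"
    and opn: "\<And>U. openin (top_of_set S1) U \<Longrightarrow> lsc_uniformly s (indicator U)"
    and f: "continuous_on S1 f" "\<And>x. x \<in> S1 \<Longrightarrow> 0 \<le> f x \<and> f x \<le> 1"
  shows "lsc_uniformly s f"
proof (rule lsc_uniformly_approx[OF s])
  show bf: "bounded_measurable f"
    by (rule bounded_measurable_unit_interval[OF f])
  fix \<epsilon> :: real assume "\<epsilon> > 0"
  then obtain m where m: "m > 0" "1 / real m < \<epsilon>"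
    using nat_approx_posE by (metis zero_less_Suc)
  define U where "U j = {x\<in>S1. real j / real m < f x}" for j
  define g where "g x = 1 / real m * (\<Sum>j=1..m. indicator (U j) x)" for x
  have "openin (top_of_set S1) (U j)" for j
  proof -
    have "U j = S1 \<inter> f -` {real j / real m<..}" by (auto simp: U_def)
    then show ?thesis using continuous_openin_preimage_gen[OF f(1)] by simp
  qed
  then have lg: "lsc_uniformly s g"
    unfolding g_def by (intro lsc_uniformly_cmult lsc_uniformly_sum[OF s] opn) auto
  have gf: "g x \<le> f x" "f x \<le> g x + 1 / real m" if "x \<in> S1" for x
  proof -
    have "g x = 1 / real m * (\<Sum>j=1..m. of_bool (real j / real m < f x))"
      using that by (simp add: g_def U_def indicator_def)
    then show "g x \<le> f x" "f x \<le> g x + 1 / real m"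
      using staircase_bounds[OF m(1), of "f x"] f(2)[OF that] by auto
  qed
  have bg: "bounded_measurable g" using lg by (simp add: lsc_uniformly_def)
  have bc: "bounded_measurable (\<lambda>_. 1 / real m)"
    by (rule bounded_measurableI[where c = "1 / real m"]) auto
  have "slice_integral s f S2 \<le> slice_integral s (\<lambda>x. g x + 1 / real m) S2"
    using gf(2) by (intro slice_integral_mono[OF s] whole_space_sets bf bounded_measurable_add bg bc)
      (auto simp: indicator_def)
  also have "\<dots> = slice_integral s g S2 + 1 / real m"
    by (simp add: slice_integral_add[OF s whole_space_sets(1) bg bc] slice_integral_const[OF s])
  finally show "\<exists>g. lsc_uniformly s g \<and> (\<forall>x\<in>S1. g x \<le> f x) \<and>
      slice_integral s f S2 - \<epsilon> \<le> slice_integral s g S2"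
    using lg gf(1) m by (intro exI[of _ g]) auto
qed

text \<open>An affine map with positive slope brings f into [0,1]. Undoing it subtracts a positive
  constant on S1, and this needs the property for the negated indicator of S1.\<close>

lemma lsc_uniformly_continuous:
  assumes s: "s \<in> S3"
    and opn: "\<And>U. openin (top_of_set S1) U \<Longrightarrow> lsc_uniformly s (indicator U)"
    and whole: "lsc_uniformly s (\<lambda>x. - indicator S1 x)"
    and f: "continuous_on S1 f" "bounded (f ` S1)"
  shows "lsc_uniformly s f"
proof -
  obtain c where c: "c > 0" "\<And>x. x \<in> S1 \<Longrightarrow> \<bar>f x\<bar> \<le> c"
    using f(2) unfolding bounded_pos by auto
  have "lsc_uniformly s (\<lambda>x. (f x + c) / (2 * c))"
  proof (rule lsc_uniformly_unit_interval[OF s opn])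
    show "continuous_on S1 (\<lambda>x. (f x + c) / (2 * c))"
      using c f by (intro continuous_intros) auto
    show "0 \<le> (f x + c) / (2 * c) \<and> (f x + c) / (2 * c) \<le> 1" if "x \<in> S1" for x
      using c(1) c(2)[OF that] by (auto simp: divide_simps)
  qed
  \<comment> \<open>On S1 this sum is f again, since the indicator is 1 there; values outside S1 do
    not matter by \<open>lsc_uniformly_cong\<close>.\<close>
  then have "lsc_uniformly s (\<lambda>x. 2 * c * ((f x + c) / (2 * c)) + c * - indicator S1 x)"
    using c whole by (intro lsc_uniformly_add[OF s] lsc_uniformly_cmult) auto
  then show ?thesis
    using c by (elim lsc_uniformly_cong[OF s]) auto
qed

end

theorem theorem4:
  fixes S1 :: "'a::polish_space set"
    and S2 :: "'b::polish_space set"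
    and S3 :: "'c::polish_space set"
    and \<Psi> :: "'c \<Rightarrow> ('a \<times> 'b) measure"
  assumes "S1 \<in> sets borel" and "S2 \<in> sets borel" and "S3 \<in> sets borel"
    and "stochastic_kernel S1 S2 S3 \<Psi>"
  shows "semi_uniform_Feller S1 S2 S3 \<Psi> \<longleftrightarrow>
    (\<forall>s\<in>S3. \<exists>\<tau>. countable_base (top_of_set S1) \<tau> \<and>
      S1 \<in> \<tau> \<and>
      (\<forall>k\<ge>1. \<forall>U :: nat \<Rightarrow> 'a set. (\<forall>i\<in>{1..k}. U i \<in> \<tau>) \<longrightarrow>
        equicontinuous_at S3 s (kernel_family S2 \<Psi> (\<Inter>i\<in>{1..k}. U i))))"
proof -
  interpret kernel S1 S2 S3 \<Psi>
    by standard fact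
  show ?thesis
    unfolding semi_uniform_Feller_iff
  proof (intro ball_cong refl iffI)
    fix s assume s: "s \<in> S3"
      and L: "\<forall>f. continuous_on S1 f \<longrightarrow> bounded (f ` S1) \<longrightarrow> lsc_uniformly s f"
    obtain D :: "'a set" where D: "countable D" "\<And>U. open U \<Longrightarrow> U \<noteq> {} \<Longrightarrow> \<exists>d\<in>D. d \<in> U"
      by (rule countable_dense_exists[THEN exE]) blast
    \<comment> \<open>A nondegenerate interval is uncountable, so it contains a radius whose sphere
      is null for the marginal at s. This choice makes the base depend on s.\<close>
    have "\<exists>r\<in>{inverse (real (n + 2))<..<inverse (real (n + 1))}.
        r \<notin> {r. measure (\<Psi> s) ((S1 \<inter> sphere d r) \<times> S2) \<noteq> 0}" for d and n :: nat
      by (rule real_interval_avoid_countable_set[OF _ countable_charged_spheres[OF s]]) simp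
    then have "\<forall>d (n :: nat). \<exists>r. r \<in> {inverse (real (n + 2))<..<inverse (real (n + 1))} \<and>
        measure (\<Psi> s) ((S1 \<inter> sphere d r) \<times> S2) = 0"
      unfolding Bex_def mem_Collect_eq not_not by blast
    then obtain r where r: "\<And>d n. r d n \<in> {inverse (real (n + 2))<..<inverse (real (n + 1))}"
      and null: "\<And>d n. measure (\<Psi> s) ((S1 \<inter> sphere d (r d n)) \<times> S2) = 0"
      unfolding choice_iff by blast
    define \<tau> where "\<tau> = insert S1 ((\<lambda>(d, n). S1 \<inter> ball d (r d n)) ` (D \<times> UNIV))"
    have cs: "continuity_set s U" if "U \<in> \<tau>" for U
      using that continuity_set_whole[OF s] continuity_set_ball[OF s null] by (auto simp: \<tau>_def)
    show "\<exists>\<tau>. countable_base (top_of_set S1) \<tau> \<and> S1 \<in> \<tau> \<and>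
      (\<forall>k\<ge>1. \<forall>U :: nat \<Rightarrow> 'a set. (\<forall>i\<in>{1..k}. U i \<in> \<tau>) \<longrightarrow>
        equicontinuous_at S3 s (kernel_family S2 \<Psi> (\<Inter>i\<in>{1..k}. U i)))"
    proof (intro exI[of _ \<tau>] conjI allI impI)
      show "countable_base (top_of_set S1) \<tau>"
        unfolding \<tau>_def by (rule countable_base_balls[OF D r])
      show "S1 \<in> \<tau>" by (simp add: \<tau>_def)
      fix k :: nat and U :: "nat \<Rightarrow> 'a set"
      assume k: "k \<ge> 1" and U: "\<forall>i\<in>{1..k}. U i \<in> \<tau>"
      have c: "continuity_set s (\<Inter>i\<in>{1..k}. U i)"
        using k U by (intro continuity_set_INT[OF s] cs) auto
      then have "(\<Inter>i\<in>{1..k}. U i) \<in> sets (borel_on S1)"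
        by (simp add: continuity_set_def)
      then show "equicontinuous_at S3 s (kernel_family S2 \<Psi> (\<Inter>i\<in>{1..k}. U i))"
        using continuity_set_lsc_uniformly[OF s c] L
        by (simp add: equicontinuous_at_kernel_family_iff[OF s])
    qed
  next
    fix s assume s: "s \<in> S3"
    assume "\<exists>\<tau>. countable_base (top_of_set S1) \<tau> \<and> S1 \<in> \<tau> \<and>
      (\<forall>k\<ge>1. \<forall>U :: nat \<Rightarrow> 'a set. (\<forall>i\<in>{1..k}. U i \<in> \<tau>) \<longrightarrow>
        equicontinuous_at S3 s (kernel_family S2 \<Psi> (\<Inter>i\<in>{1..k}. U i)))"
    then obtain \<tau> where base: "countable_base (top_of_set S1) \<tau>" and S1: "S1 \<in> \<tau>"
      and equi: "\<And>k (U :: nat \<Rightarrow> 'a set). k \<ge> 1 \<Longrightarrow> (\<forall>i\<in>{1..k}. U i \<in> \<tau>) \<Longrightarrow>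
        equicontinuous_at S3 s (kernel_family S2 \<Psi> (\<Inter>i\<in>{1..k}. U i))"
      by blast
    have \<tau>: "\<tau> \<subseteq> sets (borel_on S1)"
      using base by (auto simp: countable_base_def openin_open open_Int_sets_borel_on)
    have Inter: "lsc_uniformly s (indicator (\<Inter>\<F>)) \<and> lsc_uniformly s (\<lambda>x. - indicator (\<Inter>\<F>) x)"
      if \<F>: "finite \<F>" "\<F> \<noteq> {}" "\<F> \<subseteq> \<tau>" for \<F>
    proof -
      \<comment> \<open>The hypothesis speaks of indexed intersections, so the finite family is
        enumerated from 1 to its cardinality.\<close>
      obtain U where U: "bij_betw U {1..card \<F>} \<F>"
        using ex_bij_betw_nat_finite_1[OF \<F>(1)] by blast
      have "card \<F> \<ge> 1" using \<F> by (simp add: Suc_le_eq card_gt_0_iff)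
      then have "equicontinuous_at S3 s (kernel_family S2 \<Psi> (\<Inter>(U ` {1..card \<F>})))"
        using U \<F> by (intro equi) (auto simp: bij_betw_def)
      moreover have "\<Inter>\<F> \<in> sets (borel_on S1)"
        using sets.finite_INT[OF \<F>(1,2), of "\<lambda>A. A" "borel_on S1"] subsetD[OF \<F>(3)] subsetD[OF \<tau>]
        by simp
      ultimately show ?thesis
        using U by (simp add: equicontinuous_at_kernel_family_iff[OF s] bij_betw_def)
    qed
    have union: "lsc_uniformly s (indicator (\<Union>\<V>))" if "finite \<V>" "\<V> \<subseteq> \<tau>" for \<V>
    proof -
      have "V \<subseteq> S1" if "V \<in> \<tau>" for V
        using sets.sets_into_space[of V "borel_on S1"] that \<tau> by (auto simp: space_restrict_space)
      \<comment> \<open>Since S1 is in the base, \<open>{S1}\<close> can serve as the nonempty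
        family in the inclusion-exclusion lemma, which then speaks of plain finite unions.\<close>
      then have "\<Union>\<V> \<inter> \<Inter>{S1} = \<Union>\<V>"
        using \<open>\<V> \<subseteq> \<tau>\<close> by blast
      then show ?thesis
        using lsc_uniformly_Union_Int_Inter[OF s \<tau> Inter that, of "{S1}"] S1 by simp
    qed
    \<comment> \<open>The intersection of the single base set S1 gives the negative sign for
      constants.\<close>
    have "lsc_uniformly s (\<lambda>x. - indicator S1 x)"
      using Inter[of "{S1}"] S1 by simp
    from lsc_uniformly_continuous[OF s lsc_uniformly_open[OF s base union] this]
    show "\<forall>f. continuous_on S1 f \<longrightarrow> bounded (f ` S1) \<longrightarrow> lsc_uniformly s f"
      by simp
  qed
qed


end
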